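(* Let $C$ be an ordered category with restrictions and let $Q$ be a constellation with range. Then $\mathbf{C}(\mathbf{Q}(C))=C$ and $\mathbf{Q}(\mathbf{C}(Q))=Q$, where $\mathbf{C}(\cdot)$ is the construction turning a constellation with range into an ordered category with restrictions, and $\mathbf{Q}(\cdot)$ is the construction turning an ordered category with restrictions into a constellation with range, both as defined in the context.
   Context: Categories (object-free). A category is a class $C$ with a partial binary operation $\circ$ such that: (C1) $x\circ(y\circ z)$ exists iff $(x\circ y)\circ z$ exists, and then they are equal; (C2) if $x\circ y$ and $y\circ z$ exist then so does $x\circ(y\circ z)$; (C3) for each $x$ there are identities $e,f$ with $e\circ x$ and $x\circ f$ existing, where an identity is an element $e$ such that $x\circ e=x$ whenever $x\circ e$ exists and $e\circ x=x$ whenever $e\circ x$ exists. These $e,f$ are unique and written $D(x)=e$, $R(x)=f$; $x\circ y$ exists iff $R(x)=D(y)$. $D(C)=\{D(x)\mid x\in C\}$ is the class of identities. Constellations. A constellation is a class $Q$ with a partial binary operation $\cdot$ such that: (Q1) if $x\cdot(y\cdot z)$ exists then $(x\cdot y)\cdot z$ exists and they are equal; (Q2) if $x\cdot y$ and $y\cdot z$ exist then so does $x\cdot(y\cdot z)$; (Q3) for each $x\in Q$ there is a unique right identity $e$ with $e\cdot x=x$ (a right identity is an $e$ such that $x\cdot e=x$ whenever $x\cdot e$ exists); put $D(x)=e$ and $D(Q)=\{D(x)\mid x\in Q\}$. The standard quasiorder on $D(Q)$ is $e\leq f$ iff $e\cdot f$ exists; the natural quasiorder on $Q$ is $s\leq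 t$ iff $s=D(s)\cdot t$. A constellation with range is a constellation in which for each $s$ the set $\{e\in D(Q)\mid s\cdot e\text{ exists, and for all }f\in D(Q),\ s\cdot f\text{ exists implies }e\leq f\}$ has exactly one element, denoted $R(s)$, and such that $R(R(s)\cdot t)=R(s\cdot t)$ whenever $s\cdot t$ exists. In it the natural quasiorder is a partial order, called the natural order. Ordered categories with restrictions. This is a category $(C,\circ,D,R)$ with a partial order $\leq$ such that: (O1) if $a\leq b$, $c\leq d$ and $a\circ c$, $b\circ d$ exist then $a\circ c\leq b\circ d$; (O2) $a\leq b$ implies $D(a)\leq D(b)$; (O2$'$) $a\leq b$ implies $R(a)\leq R(b)$; (O3) if $s\in C$, $e\in D(C)$ and $e\leq D(s)$, then there is a unique $x\in C$ with $x\leq s$ and $D(x)=e$, denoted $e|s$. Constructions. For a constellation with range $(Q,\cdot,D,R)$, $\mathbf{C}(Q)=(Q,\circ,D,R,\leq)$ where $s\circ t=s\cdot t$ if $R(s)=D(t)$ and is undefined otherwise, and $\leq$ is the natural order of $Q$; this is an ordered category with restrictions. For an ordered category with restrictions $(C,\circ,D,R,\leq)$, $\mathbf{Q}(C)=(C,\cdot,D,R)$ where $s\cdot t=s\circ(R(s)|t)$ if $R(s)\leq D(t)$ and is undefined otherwise; this is a constellation with range. *)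

theory Defs
  imports Main
begin

(* A partial operation is option-valued: "x . y exists" is "comp S x y ~= None".  The locale below
   makes comp undefined outside the carrier, so that HOL equality of two such records is precisely
   equality of carriers and of partial operations (and of orders, for the extended record).
   Domain and range are not record fields: in categories and in constellations with range they are
   determined by the operation, and each is defined below from the notion it belongs to. *)

record 'a partial_algebra =
  carrier :: "'a set"
  comp :: "'a \<Rightarrow> 'a \<Rightarrow> 'a option"

record 'a ordered_partial_algebra = "'a partial_algebra" +
  le :: "('a \<times> 'a) set"

locale partial_algebra =
  fixes S :: "('a, 'm) partial_algebra_scheme"
  assumes comp_closed:
    "comp S x y = Some z \<Longrightarrow> x \<in> carrier S \<and> y \<in> carrier S \<and> z \<in> carrier S"

(* The products x . (y . z) and (x . y) . z, defined when both of their constituent products are. *)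

definition comp_right :: "('a, 'm) partial_algebra_scheme \<Rightarrow> 'a \<Rightarrow> 'a \<Rightarrow> 'a \<Rightarrow> 'a option" where
  "comp_right S x y z = Option.bind (comp S y z) (\<lambda>w. comp S x w)"

definition comp_left :: "('a, 'm) partial_algebra_scheme \<Rightarrow> 'a \<Rightarrow> 'a \<Rightarrow> 'a \<Rightarrow> 'a option" where
  "comp_left S x y z = Option.bind (comp S x y) (\<lambda>w. comp S w z)"


section \<open>Categories\<close>

definition identity :: "('a, 'm) partial_algebra_scheme \<Rightarrow> 'a \<Rightarrow> bool" where
  "identity C e \<longleftrightarrow> e \<in> carrier C \<and>
     (\<forall>x\<in>carrier C. (comp C x e \<noteq> None \<longrightarrow> comp C x e = Some x) \<and>
                    (comp C e x \<noteq> None \<longrightarrow> comp C e x = Some x))"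

(* In C1, equality of options says: one side exists iff the other does, and then they agree. *)

locale object_free_category = partial_algebra C for C :: "('a, 'm) partial_algebra_scheme" +
  assumes C1: "\<lbrakk>x \<in> carrier C; y \<in> carrier C; z \<in> carrier C\<rbrakk>
      \<Longrightarrow> comp_right C x y z = comp_left C x y z"
    and C2: "\<lbrakk>x \<in> carrier C; y \<in> carrier C; z \<in> carrier C; comp C x y \<noteq> None; comp C y z \<noteq> None\<rbrakk>
      \<Longrightarrow> comp_right C x y z \<noteq> None"
    and C3: "x \<in> carrier C \<Longrightarrow>
      \<exists>e f. identity C e \<and> identity C f \<and> comp C e x \<noteq> None \<and> comp C x f \<noteq> None"

definition cat_D :: "('a, 'm) partial_algebra_scheme \<Rightarrow> 'a \<Rightarrow> 'a" where
  "cat_D C x = (THE e. identity C e \<and> comp C e x \<noteq> None)"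

definition cat_R :: "('a, 'm) partial_algebra_scheme \<Rightarrow> 'a \<Rightarrow> 'a" where
  "cat_R C x = (THE f. identity C f \<and> comp C x f \<noteq> None)"


section \<open>Constellations with range\<close>

definition right_identity :: "('a, 'm) partial_algebra_scheme \<Rightarrow> 'a \<Rightarrow> bool" where
  "right_identity Q e \<longleftrightarrow> e \<in> carrier Q \<and>
     (\<forall>x\<in>carrier Q. comp Q x e \<noteq> None \<longrightarrow> comp Q x e = Some x)"

locale constellation = partial_algebra Q for Q :: "('a, 'm) partial_algebra_scheme" +
  assumes Q1: "\<lbrakk>x \<in> carrier Q; y \<in> carrier Q; z \<in> carrier Q; comp_right Q x y z \<noteq> None\<rbrakk>
      \<Longrightarrow> comp_left Q x y z = comp_right Q x y z"
    and Q2: "\<lbrakk>x \<in> carrier Q; y \<in> carrier Q; z \<in> carrier Q; comp Q x y \<noteq> None; comp Q y z \<noteq> None\<rbrakk>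
      \<Longrightarrow> comp_right Q x y z \<noteq> None"
    and Q3: "x \<in> carrier Q \<Longrightarrow> \<exists>!e. right_identity Q e \<and> comp Q e x = Some x"

definition con_D :: "('a, 'm) partial_algebra_scheme \<Rightarrow> 'a \<Rightarrow> 'a" where
  "con_D Q x = (THE e. right_identity Q e \<and> comp Q e x = Some x)"

definition standard_order :: "('a, 'm) partial_algebra_scheme \<Rightarrow> ('a \<times> 'a) set" where
  "standard_order Q =
     {(e, f). e \<in> con_D Q ` carrier Q \<and> f \<in> con_D Q ` carrier Q \<and> comp Q e f \<noteq> None}"

definition natural_order :: "('a, 'm) partial_algebra_scheme \<Rightarrow> ('a \<times> 'a) set" where
  "natural_order Q =
     {(s, t). s \<in> carrier Q \<and> t \<in> carrier Q \<and> comp Q (con_D Q s) t = Some s}"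

definition least_right_domains :: "('a, 'm) partial_algebra_scheme \<Rightarrow> 'a \<Rightarrow> 'a set" where
  "least_right_domains Q s =
     {e \<in> con_D Q ` carrier Q. comp Q s e \<noteq> None \<and>
        (\<forall>f \<in> con_D Q ` carrier Q. comp Q s f \<noteq> None \<longrightarrow> (e, f) \<in> standard_order Q)}"

definition con_R :: "('a, 'm) partial_algebra_scheme \<Rightarrow> 'a \<Rightarrow> 'a" where
  "con_R Q s = (THE e. e \<in> least_right_domains Q s)"

(* In R_comp, equality of options includes that R(s) . t exists whenever s . t does. *)

locale constellation_with_range = constellation Q for Q :: "('a, 'm) partial_algebra_scheme" +
  assumes range_unique: "s \<in> carrier Q \<Longrightarrow> \<exists>!e. e \<in> least_right_domains Q s"
    and R_comp: "\<lbrakk>s \<in> carrier Q; t \<in> carrier Q; comp Q s t \<noteq> None\<rbrakk>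
      \<Longrightarrow> map_option (con_R Q) (comp Q (con_R Q s) t) = map_option (con_R Q) (comp Q s t)"


section \<open>Ordered categories with restrictions\<close>

locale ordered_category_with_restrictions = object_free_category C
  for C :: "('a, 'm) ordered_partial_algebra_scheme" +
  assumes partial_order: "partial_order_on (carrier C) (le C)"
    and O1: "\<lbrakk>(a, b) \<in> le C; (c, d) \<in> le C; comp C a c = Some u; comp C b d = Some v\<rbrakk>
      \<Longrightarrow> (u, v) \<in> le C"
    and O2: "(a, b) \<in> le C \<Longrightarrow> (cat_D C a, cat_D C b) \<in> le C"
    and O2': "(a, b) \<in> le C \<Longrightarrow> (cat_R C a, cat_R C b) \<in> le C"
    and O3: "\<lbrakk>s \<in> carrier C; e \<in> cat_D C ` carrier C; (e, cat_D C s) \<in> le C\<rbrakk>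
      \<Longrightarrow> \<exists>!x. x \<in> carrier C \<and> (x, s) \<in> le C \<and> cat_D C x = e"

definition restriction :: "('a, 'm) ordered_partial_algebra_scheme \<Rightarrow> 'a \<Rightarrow> 'a \<Rightarrow> 'a" where
  "restriction C e s = (THE x. x \<in> carrier C \<and> (x, s) \<in> le C \<and> cat_D C x = e)"


section \<open>The two constructions\<close>

(* The carrier tests keep the products undefined outside the carrier, where the definite
   descriptions for domain, range and restriction are unspecified. *)

definition cat_of_con :: "'a partial_algebra \<Rightarrow> 'a ordered_partial_algebra" where
  "cat_of_con Q =
     \<lparr>carrier = carrier Q,
      comp = (\<lambda>s t. if s \<in> carrier Q \<and> t \<in> carrier Q \<and> con_R Q s = con_D Q t
                    then comp Q s t else None),
      le = natural_order Q\<rparr>"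

definition con_of_cat :: "'a ordered_partial_algebra \<Rightarrow> 'a partial_algebra" where
  "con_of_cat C =
     \<lparr>carrier = carrier C,
      comp = (\<lambda>s t. if s \<in> carrier C \<and> t \<in> carrier C \<and> (cat_R C s, cat_D C t) \<in> le C
                    then comp C s (restriction C (cat_R C s) t) else None)\<rparr>"

end

(* Both round trips come down to recovering domain, range and order from the operation.
   In Q(C) the right identities are exactly the identities of C: if e is a right identity, then
   D(e) . e is both e and D(e).  Since e . f exists for identities precisely when e <= f, the least
   identity acting on the right of s is R(s), and D(s) . t = s says s = D(s)|t, that is, s <= t.
   In C(Q) the identities are exactly the elements of D(Q), the restriction e|t is e . t, and
   s . t = (s . R(s)) . t = s . (R(s) . t). *)

theory Submission
  imports Defs
begin

section \<open>Domains, ranges and composability in object-free categories\<close>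

context object_free_category
begin

lemma identity_left: "identity C e \<Longrightarrow> comp C e x \<noteq> None \<Longrightarrow> comp C e x = Some x"
  unfolding identity_def using comp_closed by blast

lemma identity_right: "identity C e \<Longrightarrow> comp C x e \<noteq> None \<Longrightarrow> comp C x e = Some x"
  unfolding identity_def using comp_closed by blast

lemma identity_carrier: "identity C e \<Longrightarrow> e \<in> carrier C"
  by (simp add: identity_def)

text \<open>Since \<open>e'\<close> fixes \<open>x\<close>, the product e . (e' . x) exists;
  \<open>C1\<close> then makes e . e' exist, and that composite of two identities equals both
  factors.\<close>

lemma left_identity_unique:
  assumes "identity C e" "identity C e'" "comp C e x \<noteq> None" "comp C e' x \<noteq> None"
  shows "e = e'"
proof -
  have carr: "x \<in> carrier C" "e \<in> carrier C" "e' \<in> carrier C"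
    using assms comp_closed by blast+
  have "comp_right C e e' x \<noteq> None"
    using assms by (simp add: comp_right_def identity_left)
  then have "comp_left C e e' x \<noteq> None"
    using C1 carr by metis
  then have "comp C e e' \<noteq> None"
    by (auto simp: comp_left_def bind_eq_Some_conv)
  then show ?thesis
    using identity_left[OF assms(1)] identity_right[OF assms(2)] by (metis option.inject)
qed

lemma right_identity_unique:
  assumes "identity C f" "identity C f'" "comp C x f \<noteq> None" "comp C x f' \<noteq> None"
  shows "f = f'"
proof -
  have carr: "x \<in> carrier C" "f \<in> carrier C" "f' \<in> carrier C"
    using assms comp_closed by blast+
  have "comp_left C x f f' \<noteq> None"
    using assms by (simp add: comp_left_def identity_right)
  then have "comp_right C x f f' \<noteq> None"
    using C1 carr by metis
  then have "comp C f f' \<noteq> None"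
    by (auto simp: comp_right_def bind_eq_Some_conv)
  then show ?thesis
    using identity_left[OF assms(1)] identity_right[OF assms(2)] by (metis option.inject)
qed

lemma cat_D_eqI: "identity C e \<Longrightarrow> comp C e x \<noteq> None \<Longrightarrow> cat_D C x = e"
  unfolding cat_D_def using left_identity_unique by blast

lemma cat_R_eqI: "identity C f \<Longrightarrow> comp C x f \<noteq> None \<Longrightarrow> cat_R C x = f"
  unfolding cat_R_def using right_identity_unique by blast

lemma cat_D_identity: "x \<in> carrier C \<Longrightarrow> identity C (cat_D C x)"
  and cat_D_comp: "x \<in> carrier C \<Longrightarrow> comp C (cat_D C x) x = Some x"
  using C3[of x] cat_D_eqI identity_left by metis+

lemma cat_R_identity: "x \<in> carrier C \<Longrightarrow> identity C (cat_R C x)"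
  and cat_R_comp: "x \<in> carrier C \<Longrightarrow> comp C x (cat_R C x) = Some x"
  using C3[of x] cat_R_eqI identity_right by metis+

text \<open>The composite of \<open>cat_D C e\<close> with \<open>e\<close> equals \<open>e\<close>,
  and it equals \<open>cat_D C e\<close> as well because \<open>e\<close> is an identity.\<close>

lemma cat_D_of_identity: "identity C e \<Longrightarrow> cat_D C e = e"
  using cat_D_comp[of e] cat_D_identity[of e] identity_right[of e "cat_D C e"] identity_carrier
  by (metis option.distinct(1) option.inject)

lemma cat_R_of_identity: "identity C e \<Longrightarrow> cat_R C e = e"
  using cat_R_comp[of e] cat_R_identity[of e] identity_left[of e "cat_R C e"] identity_carrier
  by (metis option.distinct(1) option.inject)

lemma cat_D_image: "cat_D C ` carrier C = {e. identity C e}"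
  using cat_D_identity cat_D_of_identity identity_carrier by force

text \<open>The identity \<open>cat_D C y\<close> is inserted between \<open>x\<close> and
  \<open>y\<close>. Reassociating by \<open>C1\<close> shows that it acts on the right of
  \<open>x\<close>, hence is the range of \<open>x\<close>; conversely \<open>C2\<close> glues the
  two products that share it.\<close>

lemma comp_defined_iff:
  assumes "x \<in> carrier C" "y \<in> carrier C"
  shows "comp C x y \<noteq> None \<longleftrightarrow> cat_R C x = cat_D C y"
proof
  assume "comp C x y \<noteq> None"
  then have "comp_right C x (cat_D C y) y \<noteq> None"
    using assms by (simp add: comp_right_def cat_D_comp)
  then have "comp_left C x (cat_D C y) y \<noteq> None"
    using C1 assms cat_D_identity identity_carrier by metis
  then have "comp C x (cat_D C y) \<noteq> None"
    by (auto simp: comp_left_def bind_eq_Some_conv)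
  then show "cat_R C x = cat_D C y"
    using cat_R_eqI cat_D_identity assms by blast
next
  assume "cat_R C x = cat_D C y"
  then have "comp_right C x (cat_D C y) y \<noteq> None"
    using C2 assms cat_D_comp cat_R_comp cat_D_identity identity_carrier
    by (metis option.distinct(1))
  then show "comp C x y \<noteq> None"
    using assms by (simp add: comp_right_def cat_D_comp)
qed

text \<open>By associativity, the identity acting on the left of \<open>x\<close> also acts on the
  left of the composite.\<close>

lemma cat_D_of_comp:
  assumes "comp C x y = Some z"
  shows "cat_D C z = cat_D C x"
proof -
  have carr: "x \<in> carrier C" "y \<in> carrier C"
    using assms comp_closed by blast+
  have "comp_left C (cat_D C x) x y = Some z"
    using assms carr by (simp add: comp_left_def cat_D_comp)
  then have "comp_right C (cat_D C x) x y = Some z"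
    using C1 carr cat_D_identity identity_carrier by metis
  then have "comp C (cat_D C x) z \<noteq> None"
    using assms by (simp add: comp_right_def)
  then show ?thesis
    using cat_D_eqI cat_D_identity carr by blast
qed

end

section \<open>Restrictions in ordered categories\<close>

context ordered_category_with_restrictions
begin

lemma le_carrier: "(x, y) \<in> le C \<Longrightarrow> x \<in> carrier C \<and> y \<in> carrier C"
  and le_refl: "x \<in> carrier C \<Longrightarrow> (x, x) \<in> le C"
  and le_antisym: "(x, y) \<in> le C \<Longrightarrow> (y, x) \<in> le C \<Longrightarrow> x = y"
  using partial_order
  by (auto simp: partial_order_on_def preorder_on_def refl_on_def antisym_def)

text \<open>\<open>O2\<close> puts \<open>cat_D C x\<close> below \<open>cat_D C s\<close>, so
  \<open>O3\<close> applies and its uniqueness singles out \<open>x\<close>.\<close>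

lemma restriction_eqI: "(x, s) \<in> le C \<Longrightarrow> restriction C (cat_D C x) s = x"
  unfolding restriction_def
  using O3[of s "cat_D C x"] O2 le_carrier
  by (intro the1_equality) auto

lemma restriction_self: "s \<in> carrier C \<Longrightarrow> restriction C (cat_D C s) s = s"
  by (simp add: restriction_eqI le_refl)

lemma
  assumes "s \<in> carrier C" "identity C e" "(e, cat_D C s) \<in> le C"
  shows restriction_le: "(restriction C e s, s) \<in> le C"
    and cat_D_restriction: "cat_D C (restriction C e s) = e"
  using theI'[OF O3, of s e, folded restriction_def] assms by (auto simp: cat_D_image)

lemma restriction_of_identity:
  "identity C e \<Longrightarrow> identity C f \<Longrightarrow> (e, f) \<in> le C \<Longrightarrow> restriction C e f = e"
  using restriction_eqI[of e f] by (simp add: cat_D_of_identity)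

end

section \<open>The round trip from an ordered category through its constellation\<close>

context
  fixes C :: "'a ordered_partial_algebra"
  assumes C: "ordered_category_with_restrictions C"
begin

interpretation ordered_category_with_restrictions C
  by (rule C)

lemma carrier_con_of_cat: "carrier (con_of_cat C) = carrier C"
  by (simp add: con_of_cat_def)

lemma comp_con_of_cat:
  "comp (con_of_cat C) s t =
     (if s \<in> carrier C \<and> t \<in> carrier C \<and> (cat_R C s, cat_D C t) \<in> le C
      then comp C s (restriction C (cat_R C s) t) else None)"
  by (simp add: con_of_cat_def)

text \<open>The guard alone decides existence: the restriction of \<open>t\<close> has domain
  \<open>cat_R C s\<close>, so its composite with \<open>s\<close> is never
  \<open>None\<close>.\<close>

lemma comp_con_of_cat_defined_iff:
  assumes "s \<in> carrier C" "t \<in> carrier C"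
  shows "comp (con_of_cat C) s t \<noteq> None \<longleftrightarrow> (cat_R C s, cat_D C t) \<in> le C"
proof -
  have "comp C s (restriction C (cat_R C s) t) \<noteq> None" if "(cat_R C s, cat_D C t) \<in> le C"
    using comp_defined_iff[of s "restriction C (cat_R C s) t"] assms that
      restriction_le[of t "cat_R C s"] cat_D_restriction[of t "cat_R C s"]
      cat_R_identity le_carrier by metis
  then show ?thesis
    using assms by (simp add: comp_con_of_cat)
qed

text \<open>Restricting \<open>t\<close> to its full domain leaves \<open>t\<close>
  unchanged.\<close>

lemma comp_con_of_cat_eq_comp:
  assumes "s \<in> carrier C" "t \<in> carrier C" "cat_R C s = cat_D C t"
  shows "comp (con_of_cat C) s t = comp C s t"
  using assms le_refl cat_D_identity identity_carrier
  by (simp add: comp_con_of_cat restriction_self)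

lemma right_identity_con_of_cat: "right_identity (con_of_cat C) e \<longleftrightarrow> identity C e"
proof
  assume e: "right_identity (con_of_cat C) e"
  then have carr: "e \<in> carrier C"
    by (simp add: right_identity_def carrier_con_of_cat)
  then have "comp (con_of_cat C) (cat_D C e) e = Some e"
    using comp_con_of_cat_eq_comp[of "cat_D C e" e]
    by (simp add: cat_D_comp cat_D_identity cat_R_of_identity identity_carrier)
  moreover have "comp (con_of_cat C) (cat_D C e) e \<noteq> None \<longrightarrow>
      comp (con_of_cat C) (cat_D C e) e = Some (cat_D C e)"
    using e carr by (simp add: right_identity_def carrier_con_of_cat cat_D_identity identity_carrier)
  ultimately show "identity C e"
    using cat_D_identity[OF carr] by simp
next
  assume e: "identity C e"
  show "right_identity (con_of_cat C) e"
    unfolding right_identity_def carrier_con_of_cat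
  proof (intro conjI ballI impI)
    fix x assume x: "x \<in> carrier C" "comp (con_of_cat C) x e \<noteq> None"
    then have "(cat_R C x, e) \<in> le C"
      using comp_con_of_cat_defined_iff e by (simp add: identity_carrier cat_D_of_identity)
    \<comment> \<open>Restricting the identity \<open>e\<close> to the identity
      \<open>cat_R C x\<close> below it gives \<open>cat_R C x\<close>, which acts trivially on the
      right of \<open>x\<close>.\<close>
    then show "comp (con_of_cat C) x e = Some x"
      using e x by (simp add: comp_con_of_cat identity_carrier cat_D_of_identity
          cat_R_identity restriction_of_identity cat_R_comp)
  qed (use e identity_carrier in blast)
qed

lemma con_D_con_of_cat:
  assumes "x \<in> carrier C"
  shows "con_D (con_of_cat C) x = cat_D C x"
  unfolding con_D_def right_identity_con_of_cat
proof (rule the_equality)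
  show "identity C (cat_D C x) \<and> comp (con_of_cat C) (cat_D C x) x = Some x"
    using assms comp_con_of_cat_eq_comp[of "cat_D C x" x]
    by (simp add: cat_D_comp cat_D_identity cat_R_of_identity identity_carrier)
next
  fix e assume e: "identity C e \<and> comp (con_of_cat C) e x = Some x"
  then have "comp C e (restriction C (cat_R C e) x) = Some x"
    by (simp add: comp_con_of_cat split: if_splits)
  \<comment> \<open>A composite has the domain of its left factor, so \<open>x\<close> has the
    domain of \<open>e\<close>, which is \<open>e\<close>.\<close>
  then show "e = cat_D C x"
    using e cat_D_of_comp cat_D_of_identity by metis
qed

lemma con_D_image_con_of_cat: "con_D (con_of_cat C) ` carrier C = {e. identity C e}"
  using cat_D_image by (simp add: con_D_con_of_cat)

lemma standard_order_con_of_cat: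
  "(e, f) \<in> standard_order (con_of_cat C) \<longleftrightarrow> identity C e \<and> identity C f \<and> (e, f) \<in> le C"
  unfolding standard_order_def carrier_con_of_cat con_D_image_con_of_cat
  using comp_con_of_cat_defined_iff[of e f]
  by (auto simp: identity_carrier cat_R_of_identity cat_D_of_identity)

lemma con_R_con_of_cat:
  assumes "s \<in> carrier C"
  shows "con_R (con_of_cat C) s = cat_R C s"
proof -
  have defined_iff: "comp (con_of_cat C) s f \<noteq> None \<longleftrightarrow> (cat_R C s, f) \<in> le C"
    if "identity C f" for f
    using comp_con_of_cat_defined_iff[OF assms identity_carrier[OF that]] that
    by (simp add: cat_D_of_identity)
  \<comment> \<open>Read this way, \<open>e\<close> is above \<open>cat_R C s\<close> and below
    every identity above it; taking \<open>f\<close> to be \<open>cat_R C s\<close>, antisymmetry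
    forces equality.\<close>
  have "e \<in> least_right_domains (con_of_cat C) s \<longleftrightarrow>
      identity C e \<and> (cat_R C s, e) \<in> le C \<and>
      (\<forall>f. identity C f \<longrightarrow> (cat_R C s, f) \<in> le C \<longrightarrow> (e, f) \<in> le C)" for e
    unfolding least_right_domains_def carrier_con_of_cat con_D_image_con_of_cat
      standard_order_con_of_cat
    using defined_iff by blast
  then show ?thesis
    unfolding con_R_def
    using assms cat_R_identity[OF assms] le_refl le_antisym identity_carrier
    by (intro the_equality) auto
qed

lemma natural_order_con_of_cat: "natural_order (con_of_cat C) = le C"
proof -
  have "comp (con_of_cat C) (cat_D C s) t = Some s \<longleftrightarrow> (s, t) \<in> le C"
    if "s \<in> carrier C" "t \<in> carrier C" for s t
  proof
    assume "comp (con_of_cat C) (cat_D C s) t = Some s"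
    then have le: "(cat_D C s, cat_D C t) \<in> le C"
      and "comp C (cat_D C s) (restriction C (cat_D C s) t) = Some s"
      using that by (auto simp: comp_con_of_cat cat_D_identity cat_R_of_identity split: if_splits)
    \<comment> \<open>A left identity returns its right factor, so the composite is the restriction
      itself.\<close>
    then have "restriction C (cat_D C s) t = s"
      using identity_left[OF cat_D_identity[OF that(1)]]
      by (metis option.distinct(1) option.inject)
    then show "(s, t) \<in> le C"
      using restriction_le[of t "cat_D C s"] le that cat_D_identity by simp
  next
    assume "(s, t) \<in> le C"
    \<comment> \<open>\<open>O2\<close> opens the guard, and \<open>s\<close>, lying below
      \<open>t\<close>, is the restriction of \<open>t\<close> to \<open>cat_D C s\<close>.\<close>
    then show "comp (con_of_cat C) (cat_D C s) t = Some s"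
      using that O2 by (simp add: comp_con_of_cat cat_D_identity cat_R_of_identity
          identity_carrier restriction_eqI cat_D_comp)
  qed
  then show ?thesis
    using le_carrier by (auto simp: natural_order_def carrier_con_of_cat con_D_con_of_cat)
qed

lemma cat_of_con_of_cat: "cat_of_con (con_of_cat C) = C"
proof -
  have "comp (cat_of_con (con_of_cat C)) s t = comp C s t" for s t
  proof (cases "s \<in> carrier C \<and> t \<in> carrier C")
    case True
    \<comment> \<open>The guard of \<open>cat_of_con\<close> becomes equality of range and domain in
      \<open>C\<close>, the exact criterion for composability there; under it the two products
      agree.\<close>
    then show ?thesis
      using comp_defined_iff[of s t]
      by (auto simp: cat_of_con_def carrier_con_of_cat con_R_con_of_cat con_D_con_of_cat
          comp_con_of_cat_eq_comp)
  next
    case False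
    then have "comp C s t = None"
      using comp_closed by fastforce
    with False show ?thesis
      by (auto simp: cat_of_con_def carrier_con_of_cat)
  qed
  then have "comp (cat_of_con (con_of_cat C)) = comp C"
    by blast
  then show ?thesis
    by (intro ordered_partial_algebra.equality)
      (simp_all add: cat_of_con_def carrier_con_of_cat natural_order_con_of_cat)
qed

end

section \<open>Domains and the two quasiorders in a constellation\<close>

context constellation
begin

lemma con_D_right_identity: "x \<in> carrier Q \<Longrightarrow> right_identity Q (con_D Q x)"
  and con_D_comp: "x \<in> carrier Q \<Longrightarrow> comp Q (con_D Q x) x = Some x"
  using theI'[OF Q3, of x, folded con_D_def] by auto

lemma con_D_eqI: "right_identity Q e \<Longrightarrow> comp Q e x = Some x \<Longrightarrow> con_D Q x = e"
  unfolding con_D_def using comp_closed by (intro the1_equality[OF Q3]) auto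

lemma right_identity_carrier: "right_identity Q e \<Longrightarrow> e \<in> carrier Q"
  by (simp add: right_identity_def)

lemma right_identity_comp: "right_identity Q e \<Longrightarrow> comp Q x e \<noteq> None \<Longrightarrow> comp Q x e = Some x"
  unfolding right_identity_def using comp_closed by blast

lemma con_D_of_right_identity: "right_identity Q e \<Longrightarrow> con_D Q e = e"
  using con_D_comp[of e] right_identity_comp[of e "con_D Q e"] right_identity_carrier
  by (metis option.distinct(1) option.inject)

lemma con_D_image: "con_D Q ` carrier Q = {e. right_identity Q e}"
  using con_D_right_identity con_D_of_right_identity right_identity_carrier by force

lemma right_identity_idem: "right_identity Q e \<Longrightarrow> comp Q e e = Some e"
  using con_D_comp[of e] con_D_of_right_identity right_identity_carrier by metis

text \<open>\<open>Q2\<close> supplies x . (y . z), and \<open>Q1\<close> carries it over to (x . y)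
  . z. The elimination form names the common value.\<close>

lemma comp_assoc_defined:
  assumes "comp Q x y = Some u" "comp Q y z = Some w"
  obtains v where "comp Q x w = Some v" "comp Q u z = Some v"
proof -
  have carr: "x \<in> carrier Q" "y \<in> carrier Q" "z \<in> carrier Q"
    using assms comp_closed by blast+
  have "comp_right Q x y z \<noteq> None"
    using Q2 assms carr by simp
  with Q1[OF carr] that show thesis
    using assms by (auto simp: comp_right_def comp_left_def)
qed

text \<open>By associativity \<open>con_D Q s\<close> fixes the product on the left, and
  \<open>Q3\<close> allows only one such right identity.\<close>

lemma con_D_of_comp:
  assumes "comp Q s t = Some u"
  shows "con_D Q u = con_D Q s"
proof -
  have s: "s \<in> carrier Q"
    using assms comp_closed by blast
  have "comp Q (con_D Q s) u = Some u"
    using comp_assoc_defined[OF con_D_comp[OF s] assms] assms by metis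
  then show ?thesis
    using con_D_eqI con_D_right_identity s by blast
qed

text \<open>Writing \<open>t\<close> as D(t) . t, \<open>Q1\<close> extracts s . D(t) from s . (D(t)
  . t); conversely s . D(t) and D(t) . t combine to s . t. Questions of existence thus reduce to
  right identities.\<close>

lemma comp_defined_iff_comp_con_D:
  assumes "s \<in> carrier Q" "t \<in> carrier Q"
  shows "comp Q s t \<noteq> None \<longleftrightarrow> comp Q s (con_D Q t) \<noteq> None"
proof
  assume "comp Q s t \<noteq> None"
  then have "comp_right Q s (con_D Q t) t \<noteq> None"
    using assms by (simp add: comp_right_def con_D_comp)
  then have "comp_left Q s (con_D Q t) t \<noteq> None"
    using Q1 assms con_D_right_identity right_identity_carrier by metis
  then show "comp Q s (con_D Q t) \<noteq> None"
    by (auto simp: comp_left_def bind_eq_Some_conv)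
next
  assume "comp Q s (con_D Q t) \<noteq> None"
  then obtain u where "comp Q s (con_D Q t) = Some u"
    by blast
  then show "comp Q s t \<noteq> None"
    using comp_assoc_defined[OF _ con_D_comp[OF assms(2)]] by (metis option.distinct(1))
qed

lemma standard_order_iff:
  "(e, f) \<in> standard_order Q \<longleftrightarrow>
     right_identity Q e \<and> right_identity Q f \<and> comp Q e f \<noteq> None"
  by (simp add: standard_order_def con_D_image)

lemma least_right_domains_iff:
  "e \<in> least_right_domains Q s \<longleftrightarrow> right_identity Q e \<and> comp Q s e \<noteq> None \<and>
     (\<forall>f. right_identity Q f \<longrightarrow> comp Q s f \<noteq> None \<longrightarrow> comp Q e f \<noteq> None)"
  unfolding least_right_domains_def con_D_image standard_order_iff by blast

text \<open>Once e . f exists it equals \<open>e\<close>, as \<open>f\<close> is a right identity.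
  The natural and the standard quasiorder therefore agree on D(Q).\<close>

lemma natural_order_right_identities_iff:
  assumes "right_identity Q e" "right_identity Q f"
  shows "(e, f) \<in> natural_order Q \<longleftrightarrow> comp Q e f \<noteq> None"
  using assms right_identity_comp[OF assms(2), of e]
  by (auto simp: natural_order_def right_identity_carrier con_D_of_right_identity)

end

section \<open>Ranges in constellations\<close>

context constellation_with_range
begin

lemma con_R_mem: "s \<in> carrier Q \<Longrightarrow> con_R Q s \<in> least_right_domains Q s"
  unfolding con_R_def by (rule theI'[OF range_unique])

lemma con_R_eqI: "s \<in> carrier Q \<Longrightarrow> e \<in> least_right_domains Q s \<Longrightarrow> con_R Q s = e"
  using con_R_mem range_unique by blast

lemma con_R_right_identity: "s \<in> carrier Q \<Longrightarrow> right_identity Q (con_R Q s)"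
  and con_R_comp: "s \<in> carrier Q \<Longrightarrow> comp Q s (con_R Q s) = Some s"
  using con_R_mem[of s] right_identity_comp by (auto simp: least_right_domains_iff)

lemma con_R_of_right_identity: "right_identity Q e \<Longrightarrow> con_R Q e = e"
  by (rule con_R_eqI)
    (auto simp: least_right_domains_iff right_identity_carrier right_identity_idem)

text \<open>One direction reassociates s = s . R(s). The other uses minimality of R(s), which speaks
  only of right identities, so \<open>t\<close> is first replaced by its domain.\<close>

lemma comp_con_R_defined_iff:
  assumes "s \<in> carrier Q" "t \<in> carrier Q"
  shows "comp Q (con_R Q s) t \<noteq> None \<longleftrightarrow> comp Q s t \<noteq> None"
proof
  assume "comp Q (con_R Q s) t \<noteq> None"
  then show "comp Q s t \<noteq> None"
    using comp_assoc_defined[OF con_R_comp[OF assms(1)]] by (metis option.distinct(1) option.exhaust)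
next
  assume "comp Q s t \<noteq> None"
  then have "comp Q s (con_D Q t) \<noteq> None"
    using assms comp_defined_iff_comp_con_D by blast
  then have "comp Q (con_R Q s) (con_D Q t) \<noteq> None"
    using con_R_mem assms con_D_right_identity by (simp add: least_right_domains_iff)
  then show "comp Q (con_R Q s) t \<noteq> None"
    using assms comp_defined_iff_comp_con_D con_R_right_identity right_identity_carrier by blast
qed

lemma comp_con_R_comp:
  assumes "comp Q (con_R Q s) t = Some w" "s \<in> carrier Q"
  shows "comp Q s w = comp Q s t"
  using comp_assoc_defined[OF con_R_comp[OF assms(2)] assms(1)] by metis

end

section \<open>The round trip from a constellation through its ordered category\<close>

context
  fixes Q :: "'a partial_algebra"
  assumes Q: "constellation_with_range Q"
begin

interpretation constellation_with_range Q
  by (rule Q)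

lemma carrier_cat_of_con: "carrier (cat_of_con Q) = carrier Q"
  and le_cat_of_con: "le (cat_of_con Q) = natural_order Q"
  by (simp_all add: cat_of_con_def)

lemma comp_cat_of_con:
  "comp (cat_of_con Q) s t =
     (if s \<in> carrier Q \<and> t \<in> carrier Q \<and> con_R Q s = con_D Q t then comp Q s t else None)"
  by (simp add: cat_of_con_def)

lemma comp_cat_of_con_con_D:
  "x \<in> carrier Q \<Longrightarrow> comp (cat_of_con Q) (con_D Q x) x = Some x"
  by (simp add: comp_cat_of_con con_D_comp con_D_right_identity con_R_of_right_identity
      right_identity_carrier)

lemma comp_cat_of_con_con_R:
  "x \<in> carrier Q \<Longrightarrow> comp (cat_of_con Q) x (con_R Q x) = Some x"
  by (simp add: comp_cat_of_con con_R_comp con_R_right_identity con_D_of_right_identity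
      right_identity_carrier)

lemma identity_cat_of_con: "identity (cat_of_con Q) e \<longleftrightarrow> right_identity Q e"
proof
  assume e: "identity (cat_of_con Q) e"
  then have carr: "e \<in> carrier Q"
    by (simp add: identity_def carrier_cat_of_con)
  then have "con_D Q e \<in> carrier Q"
    using con_D_right_identity right_identity_carrier by blast
  then have "comp (cat_of_con Q) (con_D Q e) e \<noteq> None \<longrightarrow>
      comp (cat_of_con Q) (con_D Q e) e = Some (con_D Q e)"
    using e unfolding identity_def carrier_cat_of_con by blast
  \<comment> \<open>The identity \<open>e\<close> returns its left factor \<open>con_D Q e\<close>,
    while this composite is known to be \<open>e\<close>.\<close>
  then have "con_D Q e = e"
    using comp_cat_of_con_con_D[OF carr] by simp
  then show "right_identity Q e"
    using con_D_right_identity[OF carr] by simp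
next
  assume e: "right_identity Q e"
  have "comp (cat_of_con Q) x e = Some x" if "comp (cat_of_con Q) x e \<noteq> None" for x
    using that right_identity_comp[OF e, of x] by (auto simp: comp_cat_of_con split: if_splits)
  \<comment> \<open>The guard reads R(e) = D(x), and R(e) is \<open>e\<close>; so \<open>e\<close>
    is the domain of \<open>x\<close> and fixes it.\<close>
  moreover have "comp (cat_of_con Q) e x = Some x" if "comp (cat_of_con Q) e x \<noteq> None" for x
    using that con_D_comp[of x] con_R_of_right_identity[OF e]
    by (auto simp: comp_cat_of_con split: if_splits)
  ultimately show "identity (cat_of_con Q) e"
    unfolding identity_def carrier_cat_of_con using right_identity_carrier[OF e] by blast
qed

lemma cat_D_cat_of_con:
  assumes "x \<in> carrier Q"
  shows "cat_D (cat_of_con Q) x = con_D Q x"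
  unfolding cat_D_def identity_cat_of_con
proof (rule the_equality)
  show "right_identity Q (con_D Q x) \<and> comp (cat_of_con Q) (con_D Q x) x \<noteq> None"
    using assms by (simp add: con_D_right_identity comp_cat_of_con_con_D)
next
  fix e assume "right_identity Q e \<and> comp (cat_of_con Q) e x \<noteq> None"
  then show "e = con_D Q x"
    \<comment> \<open>The guard alone yields e = R(e) = D(x).\<close>
    by (auto simp: comp_cat_of_con con_R_of_right_identity split: if_splits)
qed

lemma cat_R_cat_of_con:
  assumes "x \<in> carrier Q"
  shows "cat_R (cat_of_con Q) x = con_R Q x"
  unfolding cat_R_def identity_cat_of_con
proof (rule the_equality)
  show "right_identity Q (con_R Q x) \<and> comp (cat_of_con Q) x (con_R Q x) \<noteq> None"
    using assms by (simp add: con_R_right_identity comp_cat_of_con_con_R)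
next
  fix f assume "right_identity Q f \<and> comp (cat_of_con Q) x f \<noteq> None"
  then show "f = con_R Q x"
    by (auto simp: comp_cat_of_con con_D_of_right_identity split: if_splits)
qed

lemma restriction_cat_of_con:
  assumes "right_identity Q e" "comp Q e t = Some w"
  shows "restriction (cat_of_con Q) e t = w"
  unfolding restriction_def carrier_cat_of_con le_cat_of_con
proof (rule the_equality)
  have carr: "t \<in> carrier Q" "w \<in> carrier Q"
    using assms comp_closed by blast+
  have "con_D Q w = e"
    using assms con_D_of_comp con_D_of_right_identity by simp
  then show "w \<in> carrier Q \<and> (w, t) \<in> natural_order Q \<and> cat_D (cat_of_con Q) w = e"
    using assms carr by (simp add: natural_order_def cat_D_cat_of_con)
next
  fix x assume "x \<in> carrier Q \<and> (x, t) \<in> natural_order Q \<and> cat_D (cat_of_con Q) x = e"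
  \<comment> \<open>Being below \<open>t\<close> in the natural order means x = D(x) . t, which is e
    . t.\<close>
  then show "x = w"
    using assms by (auto simp: natural_order_def cat_D_cat_of_con)
qed

lemma con_of_cat_of_con: "con_of_cat (cat_of_con Q) = Q"
proof -
  have "comp (con_of_cat (cat_of_con Q)) s t = comp Q s t" for s t
  proof (cases "s \<in> carrier Q \<and> t \<in> carrier Q")
    case True
    then have s: "s \<in> carrier Q" and t: "t \<in> carrier Q"
      by auto
    note R = con_R_right_identity[OF s]
    \<comment> \<open>R(s) <= D(t) holds iff R(s) . D(t) exists, iff R(s) . t exists, iff s . t
      exists.\<close>
    have le_iff: "(con_R Q s, con_D Q t) \<in> natural_order Q \<longleftrightarrow> comp Q s t \<noteq> None"
      using natural_order_right_identities_iff R con_D_right_identity[OF t]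
        comp_defined_iff_comp_con_D[OF right_identity_carrier[OF R] t]
        comp_con_R_defined_iff[OF s t] by blast
    have "comp (cat_of_con Q) s (restriction (cat_of_con Q) (con_R Q s) t) = comp Q s t"
      if def: "comp Q s t \<noteq> None"
    proof -
      obtain w where w: "comp Q (con_R Q s) t = Some w"
        using comp_con_R_defined_iff[OF s t] def by blast
      \<comment> \<open>The restriction is w = R(s) . t, whose domain R(s) meets the guard of
        \<open>cat_of_con\<close>; the composite is then s . w, which is s . t.\<close>
      have "con_D Q w = con_R Q s" "w \<in> carrier Q"
        using con_D_of_comp[OF w] con_D_of_right_identity[OF R] comp_closed[OF w] by auto
      then show ?thesis
        using w R s comp_con_R_comp[OF w] by (simp add: restriction_cat_of_con comp_cat_of_con)
    qed
    with le_iff s t show ?thesis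
      by (simp add: con_of_cat_def carrier_cat_of_con le_cat_of_con cat_D_cat_of_con
          cat_R_cat_of_con)
  next
    case False
    then have "comp Q s t = None"
      using comp_closed by fastforce
    with False show ?thesis
      by (auto simp: con_of_cat_def carrier_cat_of_con)
  qed
  then have "comp (con_of_cat (cat_of_con Q)) = comp Q"
    by blast
  then show ?thesis
    by (intro partial_algebra.equality) (simp_all add: con_of_cat_def carrier_cat_of_con)
qed

end

theorem proposition5p8:
  fixes C :: "'a ordered_partial_algebra" and Q :: "'b partial_algebra"
  assumes "ordered_category_with_restrictions C"
    and "constellation_with_range Q"
  shows "cat_of_con (con_of_cat C) = C \<and> con_of_cat (cat_of_con Q) = Q"
  using cat_of_con_of_cat[OF assms(1)] con_of_cat_of_con[OF assms(2)] by simp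

end
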